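(* Let $p$ be a prime, $n\ge 2$ an integer, $m=p^n$, $m'=\lfloor m/2\rfloor$, $r\in\{1,\dots,n-1\}$, and $k\in\mathbb{Z}$ with $\gcd(k,p)=1$. For an integer $s\ge1$ let $J_s=\{j\in\{1,\dots,m\}:\ j\equiv 1\pmod{p^s}\}$. Then $$U_{(p^rk)_{red}}=\frac{p^r-1}{p-1}\,U_p+\sum_{j\in J_{n-r}}U_{(jk)_{red}}-\frac{p^r-1}{p-1}\sum_{j\in J_{n-1}}U_{j_{red}}.$$
   Context: For $k=1,\dots,m'$ define $U_k=\log_2\!\left(\frac{\sin(\pi k/m)}{\sin(\pi/m)}\right)$ (so $U_1=0$). For an integer $a\not\equiv 0\pmod m$, $a_{red}$ denotes the unique integer in $\{1,\dots,m'\}$ with $a_{red}\equiv a\pmod m$ or $a_{red}\equiv -a\pmod m$. *)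

theory Defs
  imports Complex_Main "HOL-Number_Theory.Cong" "HOL-Computational_Algebra.Primes"
begin

text \<open>
  Only the values at \<open>k \<in> {1..m div 2}\<close> are meaningful; the index is an integer so that it can be
  combined with the reduction below.
\<close>

definition U :: "nat \<Rightarrow> int \<Rightarrow> real" where
  "U m k = log 2 (sin (pi * of_int k / of_nat m) / sin (pi / of_nat m))"

definition red :: "nat \<Rightarrow> int \<Rightarrow> int" where
  "red m a = (THE b. b \<in> {1..int (m div 2)} \<and>
                     ([b = a] (mod int m) \<or> [b = - a] (mod int m)))"

text \<open>The description is proper for every \<open>a\<close> not divisible by \<open>m\<close>.\<close>

lemma ex1_red:
  assumes "m > 0" and "\<not> [a = 0] (mod int m)"
  shows "\<exists>!b. b \<in> {1..int (m div 2)} \<and> ([b = a] (mod int m) \<or> [b = - a] (mod int m))"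
proof (rule ex_ex1I)
  define c where "c = a mod int m"
  have "0 \<le> c" "c \<noteq> 0" "c < int m" and "[c = a] (mod int m)"
    using assms by (simp_all add: c_def cong_def)
  then have c: "0 < c" "c < int m" "[c = a] (mod int m)"
    by linarith+
  show "\<exists>b. b \<in> {1..int (m div 2)} \<and> ([b = a] (mod int m) \<or> [b = - a] (mod int m))"
  proof (cases "c \<le> int (m div 2)")
    case True
    then show ?thesis using c by (intro exI[of _ c]) auto
  next
    case False
    have "[int m - c = 0 - a] (mod int m)"
      using c(3) by (intro cong_diff) (auto simp: cong_def)
    moreover have "int m - c \<in> {1..int (m div 2)}"
      using False c by auto
    ultimately show ?thesis by (intro exI[of _ "int m - c"]) auto
  qed
next
  fix b b'
  assume b: "b \<in> {1..int (m div 2)} \<and> ([b = a] (mod int m) \<or> [b = - a] (mod int m))"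
    and b': "b' \<in> {1..int (m div 2)} \<and> ([b' = a] (mod int m) \<or> [b' = - a] (mod int m))"
  have "int m dvd b - a \<or> int m dvd b + a" "int m dvd b' - a \<or> int m dvd b' + a"
    using b b' by (auto simp: cong_iff_dvd_diff)
  then have "int m dvd b - b' \<or> int m dvd b + b'"
    using dvd_diff[of "int m" "b - a" "b' - a"] dvd_diff[of "int m" "b + a" "b' + a"]
      dvd_add[of "int m" "b - a" "b' + a"] dvd_add[of "int m" "b + a" "b' - a"]
    by (elim disjE) simp_all
  moreover have "\<bar>b - b'\<bar> < int m" "0 < b + b'" "b + b' \<le> int m"
    using b b' by auto
  moreover have "b = b'" if "b + b' = int m"
    using that b b' by auto
  ultimately show "b = b'"
    using dvd_imp_le_int[of "b - b'" "int m"] zdvd_imp_le[of "int m" "b + b'"]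
    by (elim disjE; cases "b = b'"; simp)
qed

definition J :: "nat \<Rightarrow> nat \<Rightarrow> nat \<Rightarrow> int set" where
  "J p n s = {j \<in> {1..int (p ^ n)}. [j = 1] (mod int (p ^ s))}"

end

(* With chord m a = |1 - exp(2 pi i a / m)| = 2 |sin (pi a / m)| one has
   U m (red m a) = log_2 chord m a - log_2 chord m 1.  For gcd(k,p) = 1 the points exp(2 pi i j k / m) with
   j in J_{n-r} are exactly the p^r-th roots of c = exp(2 pi i p^r k / m), so evaluating
   z^N - c = prod (z - w) at z = 1 gives chord m (p^r k) = prod_j chord m (j k).  Taking logarithms
   leaves the defect (p^r - 1) log_2 chord m 1; the case r = k = 1 expresses log_2 chord m 1
   through U_p and the sum over J_{n-1}. *)
theory Submission
  imports Defs "HOL-Computational_Algebra.Polynomial" "HOL-Library.Real_Mod"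
begin

text \<open>Taking a modulus gives a function of every integer that is even and
  \<open>m\<close>-periodic, which is what lets \<open>red\<close> be dropped.\<close>

definition chord :: "nat \<Rightarrow> int \<Rightarrow> real" where
  "chord m a = cmod (1 - cis (2 * pi * of_int a / of_nat m))"

text \<open>The product of the \<open>z - w\<close> and \<open>z ^ N - c\<close> are monic of degree
  \<open>N\<close> and both vanish at the \<open>N\<close> distinct roots, so they coincide; then
  put \<open>z = 1\<close>.\<close>

lemma prod_one_minus_nth_roots:
  fixes c :: complex
  assumes "c \<noteq> 0" "N > 0"
  shows "(\<Prod>w | w ^ N = c. 1 - w) = 1 - c"
proof -
  let ?R = "{w. w ^ N = c}"
  let ?q = "\<Prod>w\<in>?R. [:- w, 1:]"
  have card: "card ?R = N" using assms by (rule card_nth_roots)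
  have fin: "finite ?R" using assms by (intro finite_nth_roots) auto
  have deg: "degree ?q = N"
    using card by (simp add: degree_prod_sum_eq)
  have lead: "lead_coeff ?q = 1" by (simp add: lead_coeff_prod)
  have "?q = monom 1 N - [:c:]"
  proof (rule poly_eqI_degree_lead_coeff[of _ N _ ?R])
    \<comment> \<open>For \<open>N = 0\<close> the constant \<open>c\<close> would enter the leading
      coefficient.\<close>
    have "coeff [:c:] N = 0" using \<open>N > 0\<close> by (cases N) auto
    then show "coeff ?q N = coeff (monom 1 N - [:c:]) N" using lead deg by simp
    show "degree (monom 1 N - [:c:]) \<le> N" by (intro degree_diff_le degree_monom_le) auto
    fix z assume z: "z \<in> ?R"
    then have "poly ?q z = 0" using fin by (auto simp: poly_prod intro: prod_zero)
    with z show "poly ?q z = poly (monom 1 N - [:c:]) z" by (simp add: poly_monom)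
  qed (use card deg in auto)
  then have "poly ?q 1 = poly (monom 1 N - [:c:]) 1" by simp
  then show ?thesis by (simp add: poly_prod poly_monom)
qed

text \<open>Dividing the two values reduces this to \<open>cis\<close> being 1 exactly at multiples
  of \<open>2 * pi\<close>; clearing \<open>2 * pi / m\<close> turns these into multiples of
  \<open>m\<close>.\<close>

lemma cis_eq_iff_cong:
  assumes "m > 0"
  shows "cis (2 * pi * of_int a / of_nat m) = cis (2 * pi * of_int b / of_nat m)
     \<longleftrightarrow> [a = b] (mod int m)"
proof -
  let ?x = "2 * pi * of_int a / of_nat m" and ?y = "2 * pi * of_int b / of_nat m"
  have "cis ?x = cis ?y \<longleftrightarrow> cis (?x - ?y) = 1"
    by (simp add: cis_divide[symmetric])
  also have "\<dots> \<longleftrightarrow> (\<exists>i::int. ?x - ?y = of_int i * (2 * pi))"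
    by (rule cis_eq_1_iff)
  also have "\<dots> \<longleftrightarrow> (\<exists>i::int. a - b = int m * i)"
  proof (rule arg_cong[where f = Ex], rule ext)
    fix i :: int
    have "?x - ?y = of_int i * (2 * pi) \<longleftrightarrow> 2 * pi * (of_int a - of_int b) = 2 * pi * (of_nat m * of_int i)"
      using assms by (simp add: field_simps)
    also have "\<dots> \<longleftrightarrow> real_of_int (a - b) = of_int (int m * i)"
      by (simp only: mult_cancel_left) simp
    also have "\<dots> \<longleftrightarrow> a - b = int m * i" by (rule of_int_eq_iff)
    finally show "(?x - ?y = of_int i * (2 * pi)) = (a - b = int m * i)" .
  qed
  finally show ?thesis by (simp add: cong_iff_dvd_diff dvd_def)
qed

lemma chord_cong:
  assumes "m > 0" "[a = b] (mod int m)"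
  shows "chord m a = chord m b"
  using cis_eq_iff_cong[of m a b] assms by (simp add: chord_def)

text \<open>Half-angle formula: with \<open>t = pi * a / m\<close>, the squared modulus is 2 - 2 cos
  2t = 4 sin^2 t.\<close>

lemma chord_eq_sin: "chord m a = 2 * \<bar>sin (pi * of_int a / of_nat m)\<bar>"
proof -
  let ?t = "pi * of_int a / of_nat m"
  have "(chord m a)\<^sup>2 = (1 - cos (2 * ?t))\<^sup>2 + (sin (2 * ?t))\<^sup>2"
    by (simp add: chord_def cmod_power2 mult.assoc)
  also have "\<dots> = 2 - 2 * cos (2 * ?t)"
    using sin_cos_squared_add[of "2 * ?t"] by (simp add: power2_eq_square algebra_simps)
  also have "\<dots> = (2 * \<bar>sin ?t\<bar>)\<^sup>2"
    by (simp only: cos_double_sin power_mult_distrib power2_abs) simp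
  finally show ?thesis
    by (rule power2_eq_imp_eq) (auto simp: chord_def)
qed

lemma chord_minus: "chord m (- a) = chord m a"
  by (simp add: chord_eq_sin)

lemma chord_pos:
  assumes "m > 0" "\<not> [a = 0] (mod int m)"
  shows "chord m a > 0"
  using cis_eq_iff_cong[of m a 0] assms by (simp add: chord_def)

text \<open>Since \<open>0 < b < m\<close>, both sines are positive, so the absolute values drop and
  the factors 2 cancel in the quotient.\<close>

lemma U_eq_log_chord:
  assumes "m \<ge> 2" "b \<in> {1..int (m div 2)}"
  shows "U m b = log 2 (chord m b) - log 2 (chord m 1)"
proof -
  have pos: "sin (pi * of_int c / of_nat m) > 0" if "0 < c" "c < int m" for c :: int
  proof (rule sin_gt_zero)
    show "0 < pi * of_int c / of_nat m" using that by simp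
    have "real_of_int c < of_nat m" using that by linarith
    then show "pi * of_int c / of_nat m < pi" using assms by (simp add: field_simps)
  qed
  have "sin (pi * of_int b / of_nat m) > 0" using assms by (intro pos) auto
  moreover have "sin (pi / of_nat m) > 0" using pos[of 1] assms by simp
  ultimately show ?thesis
    by (simp add: U_def chord_eq_sin log_mult log_divide)
qed

lemma U_red:
  assumes "m \<ge> 2" "\<not> [a = 0] (mod int m)"
  shows "U m (red m a) = log 2 (chord m a) - log 2 (chord m 1)"
proof -
  have "m > 0" using assms by simp
  have *: "red m a \<in> {1..int (m div 2)} \<and> ([red m a = a] (mod int m) \<or> [red m a = - a] (mod int m))"
    unfolding red_def by (rule theI'[OF ex1_red[OF \<open>m > 0\<close> assms(2)]])
  then have "chord m (red m a) = chord m a"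
    using chord_cong[OF \<open>m > 0\<close>] chord_minus by metis
  then show ?thesis using U_eq_log_chord[OF assms(1)] * by metis
qed

text \<open>An injective parametrization of \<open>J\<close>, from which its size is read
  off.\<close>

lemma J_eq_image:
  assumes "p > 0" "1 \<le> s" "s \<le> n"
  shows "J p n s = (\<lambda>i. 1 + int i * int (p ^ s)) ` {..<p ^ (n - s)}"
\<comment> \<open>For \<open>p = 1\<close> both sides are \<open>{1}\<close>; otherwise
  \<open>p ^ s > 1\<close> is available.\<close>
proof (cases "p = 1")
  case True
  then show ?thesis by (auto simp: J_def)
next
  case False
  with assms have "p ^ s > 1" by (intro one_less_power) auto
  have split: "p ^ n = p ^ (n - s) * p ^ s"
    using assms by (simp flip: power_add)
  show ?thesis
  proof (intro equalityI subsetI)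
    fix j assume "j \<in> J p n s"
    then have j: "1 \<le> j" "j \<le> int (p ^ n)" "int (p ^ s) dvd j - 1"
      by (auto simp: J_def cong_iff_dvd_diff)
    then obtain i where i: "j - 1 = int (p ^ s) * i" by (auto elim: dvdE)
    have "i \<ge> 0" using i j(1) \<open>p > 0\<close>
      by (metis diff_ge_0_iff_ge of_nat_0_less_iff zero_le_mult_iff not_less zero_less_power)
    \<comment> \<open>The shift by 1 makes this strict: \<open>j \<le> p ^ n\<close> gives
      \<open>j - 1 < p ^ n\<close>.\<close>
    have "int (p ^ s) * i < int (p ^ s) * int (p ^ (n - s))"
      using i j(2) split by (simp add: mult.commute)
    then have "i < int (p ^ (n - s))" using \<open>p > 0\<close> by (simp add: mult_less_cancel_left)
    with i \<open>i \<ge> 0\<close> show "j \<in> (\<lambda>i. 1 + int i * int (p ^ s)) ` {..<p ^ (n - s)}"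
      by (intro image_eqI[of _ _ "nat i"]) (auto simp: algebra_simps nat_less_iff)
  next
    fix j assume "j \<in> (\<lambda>i. 1 + int i * int (p ^ s)) ` {..<p ^ (n - s)}"
    then obtain i where i: "i < p ^ (n - s)" "j = 1 + int i * int (p ^ s)" by auto
    have "Suc i * p ^ s \<le> p ^ n" unfolding split using i(1) by (intro mult_right_mono) auto
    then have "1 + i * p ^ s \<le> p ^ n" using \<open>p ^ s > 1\<close> by simp
    then have "int (1 + i * p ^ s) \<le> int (p ^ n)" by (simp only: of_nat_le_iff)
    then show "j \<in> J p n s" using i by (simp add: J_def cong_iff_dvd_diff)
  qed
qed

lemma card_J:
  assumes "p > 0" "1 \<le> s" "s \<le> n"
  shows "card (J p n s) = p ^ (n - s)"
  unfolding J_eq_image[OF assms] using assms by (subst card_image) (auto simp: inj_on_def)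

lemma finite_J: "finite (J p n s)"
  by (rule finite_subset[of _ "{1..int (p ^ n)}"]) (auto simp: J_def)

text \<open>The factorization at 1, in absolute value. What has to be shown is that
  \<open>j \<mapsto> e (j * k)\<close> is a bijection from \<open>J\<close> onto the roots of
  \<open>w ^ (p ^ r) = e (p ^ r * k)\<close>.\<close>

lemma chord_power_mult:
  assumes "p > 0" "1 \<le> r" "r < n" "coprime k (int p)"
  shows "chord (p ^ n) (int (p ^ r) * k) = (\<Prod>j\<in>J p n (n - r). chord (p ^ n) (j * k))"
proof -
  let ?m = "p ^ n"
  define e where "e a = cis (2 * pi * of_int a / of_nat ?m)" for a :: int
  have m: "?m > 0" using assms by simp
  have e_iff: "e a = e b \<longleftrightarrow> [a = b] (mod int ?m)" for a b
    unfolding e_def by (rule cis_eq_iff_cong[OF m])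
  have e_pow: "e a ^ N = e (int N * a)" for a N
    unfolding e_def DeMoivre by (simp add: algebra_simps)
  let ?J = "J p n (n - r)" and ?c = "e (int (p ^ r) * k)"
  have cop: "coprime k (int ?m)" using assms by simp
  have inj: "inj_on (\<lambda>j. e (j * k)) ?J"
  proof (rule inj_onI)
    fix i j assume ij: "i \<in> ?J" "j \<in> ?J" "e (i * k) = e (j * k)"
    \<comment> \<open>The unit \<open>k\<close> cancels modulo \<open>m\<close>, and congruent
      elements of \<open>{1..m}\<close> are equal.\<close>
    then have "[i = j] (mod int ?m)"
      using cop by (simp add: e_iff cong_mult_rcancel)
    then have "int ?m dvd i - j" by (simp add: cong_iff_dvd_diff)
    moreover have "\<bar>i - j\<bar> < int ?m" using ij by (auto simp: J_def)
    ultimately show "i = j" using dvd_imp_le_int[of "i - j" "int ?m"] by auto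
  qed
  have nz: "?c \<noteq> 0" by (simp add: e_def)
  have N: "p ^ r > 0" using assms by simp
  \<comment> \<open>There are \<open>p ^ r\<close> distinct values and as many roots, so inclusion
    suffices.\<close>
  have "(\<lambda>j. e (j * k)) ` ?J = {w. w ^ (p ^ r) = ?c}"
  proof (rule card_subset_eq)
    show "finite {w. w ^ (p ^ r) = ?c}" using N by (rule finite_nth_roots)
    show "card ((\<lambda>j. e (j * k)) ` ?J) = card {w. w ^ (p ^ r) = ?c}"
      unfolding card_image[OF inj] card_nth_roots[OF nz N] using assms by (simp add: card_J)
    show "(\<lambda>j. e (j * k)) ` ?J \<subseteq> {w. w ^ (p ^ r) = ?c}"
    proof clarify
      fix j assume "j \<in> ?J"
      then have "int (p ^ (n - r)) dvd j - 1" by (simp add: J_def cong_iff_dvd_diff)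
      \<comment> \<open>Multiplying by \<open>p ^ r\<close> lifts the congruence from modulus
        \<open>p ^ (n - r)\<close> to \<open>p ^ n\<close>.\<close>
      then have "int (p ^ r) * int (p ^ (n - r)) dvd int (p ^ r) * (j - 1)"
        by (rule mult_dvd_mono[OF dvd_refl])
      moreover have "int (p ^ r) * int (p ^ (n - r)) = int ?m"
        using assms by (simp flip: power_add)
      ultimately have "int ?m dvd int (p ^ r) * (j - 1) * k" by (metis dvd_mult2)
      then have "[int (p ^ r) * (j * k) = int (p ^ r) * k] (mod int ?m)"
        by (simp add: cong_iff_dvd_diff algebra_simps)
      then show "e (j * k) ^ (p ^ r) = ?c" unfolding e_pow e_iff .
    qed
  qed
  then have "1 - ?c = (\<Prod>w\<in>(\<lambda>j. e (j * k)) ` ?J. 1 - w)"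
    using prod_one_minus_nth_roots[OF nz N] by simp
  also have "\<dots> = (\<Prod>j\<in>?J. 1 - e (j * k))"
    by (simp add: prod.reindex[OF inj])
  finally have "cmod (1 - ?c) = (\<Prod>j\<in>?J. cmod (1 - e (j * k)))"
    by (simp add: prod_norm)
  then show ?thesis by (simp only: chord_def e_def)
qed

text \<open>Each of the \<open>p ^ r\<close> summands contributes one
  \<open>log 2 (chord m 1)\<close>; the remaining logarithms combine through
  \<open>chord_power_mult\<close>.\<close>

lemma sum_U_red_J:
  assumes "prime p" "1 \<le> r" "r < n" "coprime k (int p)"
  shows "(\<Sum>j\<in>J p n (n - r). U (p ^ n) (red (p ^ n) (j * k))) =
     log 2 (chord (p ^ n) (int (p ^ r) * k)) - real p ^ r * log 2 (chord (p ^ n) 1)"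
proof -
  let ?m = "p ^ n" and ?J = "J p n (n - r)"
  have p: "p \<ge> 2" "p > 0" using prime_ge_2_nat[OF assms(1)] by auto
  have "p ^ 1 \<le> p ^ n" using p assms by (intro power_increasing) auto
  then have m: "?m \<ge> 2" "?m > 0" using p by auto
  \<comment> \<open>As \<open>n - r \<ge> 1\<close>, each \<open>j\<close> is 1 modulo
    \<open>p\<close>, so \<open>j * k\<close> stays prime to \<open>p\<close>. Hence no chord
    vanishes and the logarithms below are genuine.\<close>
  have nz: "\<not> [j * k = 0] (mod int ?m)" if "j \<in> ?J" for j
  proof
    assume "[j * k = 0] (mod int ?m)"
    moreover have p_dvd: "int p dvd int (p ^ s)" if "s > 0" for s using that by simp
    ultimately have "int p dvd j * k"
      using assms by (metis cong_0_iff dvd_trans gr_zeroI not_less_zero)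
    moreover have "[j = 1] (mod int (p ^ (n - r)))" using that by (simp add: J_def)
    then have "[j = 1] (mod int p)"
      using assms p_dvd[of "n - r"] cong_dvd_modulus by (metis zero_less_diff)
    then have "coprime j (int p)" by (metis cong_imp_coprime cong_sym coprime_1_left)
    ultimately have "coprime (j * k) (int p)" "int p dvd j * k" using assms(4) by simp_all
    then have "int p dvd 1" by (rule coprime_common_divisor[OF _ _ dvd_refl])
    then show False using p by simp
  qed
  have "(\<Sum>j\<in>?J. U ?m (red ?m (j * k))) = (\<Sum>j\<in>?J. log 2 (chord ?m (j * k)) - log 2 (chord ?m 1))"
    using nz m by (intro sum.cong refl U_red) auto
  also have "\<dots> = (\<Sum>j\<in>?J. log 2 (chord ?m (j * k))) - real (card ?J) * log 2 (chord ?m 1)"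
    by (simp add: sum_subtractf)
  also have "(\<Sum>j\<in>?J. log 2 (chord ?m (j * k))) = log 2 (\<Prod>j\<in>?J. chord ?m (j * k))"
    unfolding log_def sum_divide_distrib[symmetric] using chord_pos[OF m(2) nz]
    by (subst ln_prod) (auto simp: finite_J less_imp_neq[symmetric])
  also have "(\<Prod>j\<in>?J. chord ?m (j * k)) = chord ?m (int (p ^ r) * k)"
    using p assms by (intro chord_power_mult[symmetric]) auto
  also have "real (card ?J) = real p ^ r" using p assms by (simp add: card_J)
  finally show ?thesis .
qed

theorem theorem1:
  fixes p n m r :: nat and k :: int
  assumes "prime p" and "n \<ge> 2" and "m = p ^ n" and "r \<in> {1..n - 1}" and "gcd k (int p) = 1"
  shows "U m (red m (int (p ^ r) * k)) =
           (real p ^ r - 1) / (real p - 1) * U m (int p)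
           + (\<Sum>j\<in>J p n (n - r). U m (red m (j * k)))
           - (real p ^ r - 1) / (real p - 1) * (\<Sum>j\<in>J p n (n - 1). U m (red m j))"
proof -
  have r: "1 \<le> r" "r < n" and k: "coprime k (int p)" and "1 < n"
    using assms by (auto simp: coprime_iff_gcd_eq_1)
  have p: "p \<ge> 2" using assms(1) by (rule prime_ge_2_nat)
  \<comment> \<open>From \<open>n \<ge> 2\<close> comes \<open>p \<le> m div 2\<close>, so
    \<open>p\<close> is its own reduced representative and \<open>U m p\<close> can be evaluated
    directly.\<close>
  have "p ^ 2 \<le> m" unfolding assms(3) using p assms(2) by (intro power_increasing) auto
  moreover have "2 * p \<le> p ^ 2" using p by (simp add: power2_eq_square)
  ultimately have "2 * p \<le> m" by linarith
  then have m: "m \<ge> 2" and "p \<le> m div 2" using p by auto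
  let ?L = "\<lambda>a. log 2 (chord m a)"
  \<comment> \<open>Otherwise \<open>p ^ (n - r)\<close> would divide \<open>k\<close>, although
    \<open>r < n\<close> and \<open>k\<close> is prime to \<open>p\<close>.\<close>
  have nz: "\<not> [int (p ^ r) * k = 0] (mod int m)"
  proof
    assume "[int (p ^ r) * k = 0] (mod int m)"
    moreover have "int m = int (p ^ r) * int (p ^ (n - r))"
      using r assms(3) by (simp flip: power_add)
    ultimately have "int (p ^ r) * int (p ^ (n - r)) dvd int (p ^ r) * k" by (simp add: cong_0_iff)
    then have "int (p ^ (n - r)) dvd k" using p by simp
    then have "int p dvd k" using r by (metis dvd_power dvd_trans of_nat_power zero_less_diff)
    then show False using k p by (auto simp: coprime_absorb_right)
  qed
  have "U m (red m (int (p ^ r) * k)) = ?L (int (p ^ r) * k) - ?L 1"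
    by (rule U_red[OF m nz])
  moreover have "U m (int p) = ?L (int p) - ?L 1"
    using m p \<open>p \<le> m div 2\<close> by (intro U_eq_log_chord) auto
  moreover have "(\<Sum>j\<in>J p n (n - r). U m (red m (j * k))) = ?L (int (p ^ r) * k) - real p ^ r * ?L 1"
    using sum_U_red_J[OF assms(1) r k] by (simp add: assms(3))
  \<comment> \<open>The case \<open>r = k = 1\<close>: subtracting this sum from
    \<open>U m p\<close> leaves \<open>(p - 1) * ?L 1\<close>.\<close>
  moreover have "(\<Sum>j\<in>J p n (n - 1). U m (red m j)) = ?L (int p) - real p * ?L 1"
    using sum_U_red_J[OF assms(1) order_refl \<open>1 < n\<close>, of 1] by (simp add: assms(3))
  \<comment> \<open>The coefficient is chosen so that this difference becomes the defect
    \<open>(p ^ r - 1) * ?L 1\<close>; the rest is linear in the logarithms.\<close>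
  moreover have "(real p ^ r - 1) / (real p - 1) * ((real p - 1) * ?L 1) = (real p ^ r - 1) * ?L 1"
    using p by simp
  ultimately show ?thesis by (simp only:) (simp add: algebra_simps)
qed

end
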